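(* Let $m,n\ge2$ and let $G$ be a grid-labelled graph of type $(m,n)$ (possibly with additional horizontal and vertical edges). (1) If $G$ has exactly two diagonal edges, then $\rho(G)$ is separable if and only if these two edges are $\{(i,j),(k,l)\}$ and $\{(i,l),(k,j)\}$ for some rows $i\neq k$ and columns $j\neq l$. (2) If $G$ has exactly three diagonal edges, then $\rho(G)$ is separable if and only if either (a) there are rows $i\neq k$ and pairwise distinct columns $j_1,j_2,j_3$ such that the diagonal edges are $\{(i,j_1),(k,j_2)\}$, $\{(i,j_2),(k,j_3)\}$, $\{(k,j_1),(i,j_3)\}$; or (b) there are pairwise distinct rows $i_1,i_2,i_3$ and columns $j\neq l$ such that the diagonal edges are $\{(i_1,j),(i_2,l)\}$, $\{(i_2,j),(i_3,l)\}$, $\{(i_1,l),(i_3,j)\}$.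
   Context: A grid-labelled graph of type $(a,b)$ is a simple graph $G$ whose vertex set is the grid $[a]\times[b]$. If $G$ has $m\ge1$ edges, $\rho(G)=L(G)/(2m)$, where $L(G)$ is the combinatorial Laplacian, viewed as a density matrix on $\mathbb{C}^a\otimes\mathbb{C}^b$ with vertex $(i,j)$ corresponding to $|i\rangle\otimes|j\rangle$; separable means a convex combination of tensor products of density matrices. An edge $\{(i,j),(k,l)\}$ is horizontal if $i=k$, vertical if $j=l$, and diagonal if $i\neq k$ and $j\neq l$. *)

theory Defs
  imports Complex_Main
begin

definition grid :: "nat \<Rightarrow> nat \<Rightarrow> (nat \<times> nat) set" where
  "grid a b = {..<a} \<times> {..<b}"

definition grid_graph :: "nat \<Rightarrow> nat \<Rightarrow> (nat \<times> nat) set set \<Rightarrow> bool" where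
  "grid_graph a b E \<longleftrightarrow>
     E \<subseteq> {{u, v} | u v. u \<in> grid a b \<and> v \<in> grid a b \<and> u \<noteq> v}"

definition degree :: "(nat \<times> nat) set set \<Rightarrow> nat \<times> nat \<Rightarrow> nat" where
  "degree E u = card {e \<in> E. u \<in> e}"

definition laplacian :: "(nat \<times> nat) set set \<Rightarrow> (nat \<times> nat) \<Rightarrow> (nat \<times> nat) \<Rightarrow> complex" where
  "laplacian E u v =
     (if u = v then of_nat (degree E u) else if {u, v} \<in> E then -1 else 0)"

(* rho(G) = L(G) / (2 m), m = number of edges; vertex (i,j) corresponds to |i> (x) |j> *)
definition rho :: "(nat \<times> nat) set set \<Rightarrow> (nat \<times> nat) \<Rightarrow> (nat \<times> nat) \<Rightarrow> complex" where
  "rho E u v = laplacian E u v / of_nat (2 * card E)"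

definition density_matrix :: "nat \<Rightarrow> (nat \<Rightarrow> nat \<Rightarrow> complex) \<Rightarrow> bool" where
  "density_matrix d A \<longleftrightarrow>
     (\<forall>i<d. \<forall>j<d. A i j = cnj (A j i)) \<and>
     (\<forall>v :: nat \<Rightarrow> complex. 0 \<le> Re (\<Sum>i<d. \<Sum>j<d. cnj (v i) * A i j * v j)) \<and>
     (\<Sum>i<d. A i i) = 1"

(* A state on C^a (x) C^b, given as a matrix indexed by pairs, is separable if it is a
   convex combination of tensor products of density matrices;
   (A (x) B)((i,j),(k,l)) = A i k * B j l. *)
definition separable :: "nat \<Rightarrow> nat \<Rightarrow> ((nat \<times> nat) \<Rightarrow> (nat \<times> nat) \<Rightarrow> complex) \<Rightarrow> bool" where
  "separable a b \<rho> \<longleftrightarrow>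
     (\<exists>(r::nat) (p :: nat \<Rightarrow> real) (A :: nat \<Rightarrow> nat \<Rightarrow> nat \<Rightarrow> complex)
        (B :: nat \<Rightarrow> nat \<Rightarrow> nat \<Rightarrow> complex).
        (\<forall>t<r. 0 \<le> p t \<and> density_matrix a (A t) \<and> density_matrix b (B t)) \<and>
        (\<Sum>t<r. p t) = 1 \<and>
        (\<forall>i<a. \<forall>j<b. \<forall>k<a. \<forall>l<b.
           \<rho> (i, j) (k, l) = (\<Sum>t<r. of_real (p t) * A t i k * B t j l)))"

definition diagonal_edges :: "(nat \<times> nat) set set \<Rightarrow> (nat \<times> nat) set set" where
  "diagonal_edges E = {e \<in> E. \<exists>i j k l. e = {(i, j), (k, l)} \<and> i \<noteq> k \<and> j \<noteq> l}"

end

theory Submission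
  imports Defs
begin

text \<open>Partial transposition replaces a diagonal edge \<open>{(i, j), (k, l)}\<close> by \<open>{(i, l), (k, j)}\<close> in the
  off-diagonal part of the Laplacian, so the entries of the partial transpose sum to zero. For a
  separable state \<open>\<Sum>p A \<otimes> B\<close> this sum is \<open>\<Sum>p \<langle>1, A 1\<rangle> \<langle>1, B 1\<rangle>\<close> with nonnegative terms, so in each term
  of positive weight \<open>A\<close> or \<open>B\<close> annihilates the all-ones vector. Hence all row sums of the partial
  transpose vanish: every vertex lies on as many diagonal edges as transposed diagonal edges. With
  two or three diagonal edges this forces the listed configurations. Conversely, horizontal and
  vertical edges contribute projections onto product vectors, and the listed configurations are
  cyclic shifts, which the discrete Fourier transform splits into product vectors as well.\<close>

section \<open>Laplacians as sums of single-edge contributions\<close>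

definition edge_laplacian :: "(nat \<times> nat) set \<Rightarrow> nat \<times> nat \<Rightarrow> nat \<times> nat \<Rightarrow> complex" where
  "edge_laplacian e u v = (if u \<in> e \<and> v \<in> e then (if u = v then 1 else -1) else 0)"

definition diagonal :: "(nat \<times> nat) set \<Rightarrow> bool" where
  "diagonal e \<longleftrightarrow> (\<exists>i j k l. e = {(i, j), (k, l)} \<and> i \<noteq> k \<and> j \<noteq> l)"

text \<open>For a diagonal edge these are the two other corners of the rectangle it spans, that is,
  its image under partial transposition. For a horizontal or vertical edge the set is empty. The
  formula avoids choosing an order of the endpoints.\<close>

definition opposite :: "(nat \<times> nat) set \<Rightarrow> (nat \<times> nat) set" where
  "opposite e = fst ` e \<times> snd ` e - e"

lemma diagonal_edges_eq: "diagonal_edges E = {e \<in> E. diagonal e}"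
  by (simp add: diagonal_edges_def diagonal_def)

lemma grid_graph_finite:
  assumes "grid_graph a b E"
  shows "finite E"
proof -
  have "E \<subseteq> Pow (grid a b)"
    using assms by (auto simp: grid_graph_def)
  moreover have "finite (Pow (grid a b))"
    by (simp add: grid_def)
  ultimately show ?thesis
    by (rule finite_subset)
qed

lemma grid_graph_edgeE:
  assumes "grid_graph a b E" and "e \<in> E"
  obtains i j k l where "e = {(i, j), (k, l)}" "(i, j) \<noteq> (k, l)" "i < a" "k < a" "j < b" "l < b"
  using assms by (force simp: grid_graph_def grid_def)

lemma grid_graph_edge_subset: "grid_graph a b E \<Longrightarrow> e \<in> E \<Longrightarrow> e \<subseteq> grid a b"
  by (auto simp: grid_graph_def)

text \<open>Additivity reduces everything to single edges: the diagonal counts incident edges, and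
  for \<open>u \<noteq> v\<close> only the edge \<open>{u, v}\<close> contains both
  vertices.\<close>

lemma laplacian_eq_sum_edges:
  assumes "grid_graph a b E"
  shows "laplacian E u v = (\<Sum>e\<in>E. edge_laplacian e u v)"
proof (cases "u = v")
  case True
  have "(\<Sum>e\<in>E. edge_laplacian e u u) = (\<Sum>e\<in>{e \<in> E. u \<in> e}. 1)"
    using grid_graph_finite[OF assms]
    by (simp add: edge_laplacian_def sum.If_cases Int_def)
  then show ?thesis
    using True by (simp add: laplacian_def degree_def)
next
  case False
  have *: "u \<in> e \<and> v \<in> e \<longleftrightarrow> e = {u, v}" if "e \<in> E" for e
    using grid_graph_edgeE[OF assms that] False by (auto simp: doubleton_eq_iff)
  have "(\<Sum>e\<in>E. edge_laplacian e u v) = (\<Sum>e\<in>E. if e = {u, v} then -1 else 0)"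
    using False * by (intro sum.cong) (auto simp: edge_laplacian_def)
  also have "\<dots> = (if {u, v} \<in> E then -1 else 0)"
    using grid_graph_finite[OF assms] by simp
  finally show ?thesis
    using False by (simp add: laplacian_def)
qed

lemma sum_grid:
  fixes f :: "nat \<times> nat \<Rightarrow> 'a::comm_monoid_add"
  shows "(\<Sum>i<a. \<Sum>j<b. f (i, j)) = sum f (grid a b)"
  by (simp add: grid_def sum.cartesian_product)

lemma trace_edge_laplacian:
  assumes "grid_graph a b E" and "e \<in> E"
  shows "(\<Sum>u\<in>grid a b. edge_laplacian e u u) = 2"
proof -
  obtain i j k l where e: "e = {(i, j), (k, l)}" "(i, j) \<noteq> (k, l)"
    using grid_graph_edgeE[OF assms] by metis
  have "finite (grid a b)"
    by (simp add: grid_def)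
  then have "(\<Sum>u\<in>grid a b. edge_laplacian e u u) = of_nat (card (grid a b \<inter> e))"
    by (simp add: edge_laplacian_def sum.If_cases Int_def)
  also have "grid a b \<inter> e = e"
    using grid_graph_edge_subset[OF assms] by blast
  finally show ?thesis
    using e by simp
qed

lemma trace_rho:
  assumes "grid_graph a b E" and "E \<noteq> {}"
  shows "(\<Sum>u\<in>grid a b. rho E u u) = 1"
proof -
  have "card E > 0"
    using assms grid_graph_finite card_gt_0_iff by blast
  have "(\<Sum>u\<in>grid a b. laplacian E u u) = (\<Sum>e\<in>E. \<Sum>u\<in>grid a b. edge_laplacian e u u)"
    unfolding laplacian_eq_sum_edges[OF assms(1)] by (rule sum.swap)
  also have "\<dots> = of_nat (2 * card E)"
    using trace_edge_laplacian[OF assms(1)] by simp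
  finally show ?thesis
    using \<open>card E > 0\<close> by (simp add: rho_def flip: sum_divide_distrib)
qed

section \<open>The cone generated by product vectors\<close>

text \<open>These are the unnormalised separable matrices, closed under sums without bookkeeping of
  weights. The generating vectors are nonzero on the index range so that each can be rescaled to a
  density matrix.\<close>

inductive product_cone :: "nat \<Rightarrow> nat \<Rightarrow> (nat \<times> nat \<Rightarrow> nat \<times> nat \<Rightarrow> complex) \<Rightarrow> bool"
  for a b where
  zero: "product_cone a b (\<lambda>u v. 0)"
| vectors: "0 \<le> w \<Longrightarrow> \<exists>i<a. x i \<noteq> 0 \<Longrightarrow> \<exists>j<b. y j \<noteq> 0 \<Longrightarrow>
    product_cone a b (\<lambda>u v. complex_of_real w * (x (fst u) * cnj (x (fst v))) *
      (y (snd u) * cnj (y (snd v))))"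
| add: "product_cone a b M \<Longrightarrow> product_cone a b N \<Longrightarrow> product_cone a b (\<lambda>u v. M u v + N u v)"

lemma product_cone_sum:
  assumes "finite T" and "\<And>t. t \<in> T \<Longrightarrow> product_cone a b (M t)"
  shows "product_cone a b (\<lambda>u v. \<Sum>t\<in>T. M t u v)"
  using assms by (induction T rule: finite_induct) (auto intro: product_cone.intros)

lemma product_cone_scale:
  assumes "product_cone a b M" and "0 \<le> c"
  shows "product_cone a b (\<lambda>u v. complex_of_real c * M u v)"
  using assms(1)
proof induction
  case zero
  then show ?case by (simp add: product_cone.zero)
next
  case (vectors w x y)
  then have "product_cone a b (\<lambda>u v. complex_of_real (c * w) * (x (fst u) * cnj (x (fst v))) *
      (y (snd u) * cnj (y (snd v))))"
    using assms(2) by (intro product_cone.vectors) auto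
  then show ?case by (simp add: mult.assoc)
next
  case (add M N)
  then show ?case using product_cone.add[OF add.IH] by (simp add: distrib_left)
qed

section \<open>From cone elements to separable states\<close>

lemma density_matrix_hermitian: "density_matrix d A \<Longrightarrow> i < d \<Longrightarrow> j < d \<Longrightarrow> A i j = cnj (A j i)"
  unfolding density_matrix_def by blast

lemma density_matrix_trace: "density_matrix d A \<Longrightarrow> (\<Sum>i<d. A i i) = 1"
  unfolding density_matrix_def by blast

text \<open>The form of the normalised rank-one matrix at \<open>v\<close> is the squared modulus of
  the inner product of \<open>v\<close> and \<open>x\<close>, divided by \<open>s\<close>.\<close>

lemma density_matrix_vector:
  fixes x :: "nat \<Rightarrow> complex"
  assumes "\<exists>i<d. x i \<noteq> 0"
  defines "s \<equiv> (\<Sum>i<d. (cmod (x i))\<^sup>2)"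
  shows "s > 0" and "density_matrix d (\<lambda>i k. x i * cnj (x k) / of_real s)"
proof -
  from assms(1) obtain i where "i < d" "x i \<noteq> 0" by blast
  then show s: "s > 0"
    unfolding s_def by (intro sum_pos2[of _ i]) auto
  have "0 \<le> Re (\<Sum>i<d. \<Sum>j<d. cnj (v i) * (x i * cnj (x j) / of_real s) * v j)" for v
  proof -
    define z where "z = (\<Sum>i<d. cnj (v i) * x i)"
    have "(\<Sum>i<d. \<Sum>j<d. cnj (v i) * (x i * cnj (x j) / of_real s) * v j) = z * cnj z / of_real s"
      by (simp add: z_def sum_product sum_divide_distrib mult.assoc)
        (simp add: mult_ac)
    also have "\<dots> = of_real ((cmod z)\<^sup>2 / s)"
      by (simp add: complex_norm_square del: of_real_power)
    finally show ?thesis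
      using s by (simp add: Re_divide_of_real)
  qed
  moreover have "(\<Sum>i<d. x i * cnj (x i) / of_real s) = 1"
  proof -
    have "(\<Sum>i<d. x i * cnj (x i)) = of_real s"
      by (simp add: s_def complex_norm_square del: of_real_power)
    then show ?thesis
      using s by (simp flip: sum_divide_distrib)
  qed
  ultimately show "density_matrix d (\<lambda>i k. x i * cnj (x k) / of_real s)"
    by (simp add: density_matrix_def mult.commute)
qed

lemma product_cone_decomposition:
  assumes "product_cone a b M"
  shows "\<exists>(r::nat) p A B. (\<forall>t<r. 0 \<le> p t \<and> density_matrix a (A t) \<and> density_matrix b (B t)) \<and>
    (\<forall>i<a. \<forall>j<b. \<forall>k<a. \<forall>l<b. M (i, j) (k, l) = (\<Sum>t<r. of_real (p t) * A t i k * B t j l))"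
  using assms
proof induction
  case zero
  show ?case by (rule exI[of _ 0]) simp
next
  case (vectors w x y)
  define s where "s = (\<Sum>i<a. (cmod (x i))\<^sup>2)"
  define q where "q = (\<Sum>i<b. (cmod (y i))\<^sup>2)"
  note X = density_matrix_vector[OF vectors(2), folded s_def]
  note Y = density_matrix_vector[OF vectors(3), folded q_def]
  \<comment> \<open>The weight absorbs the two squared norms removed by normalising \<open>x\<close>
    and \<open>y\<close>.\<close>
  show ?case
    using X Y vectors(1)
    by (intro exI[of _ 1] exI[of _ "\<lambda>_. w * s * q"]
        exI[of _ "\<lambda>_ i k. x i * cnj (x k) / of_real s"]
        exI[of _ "\<lambda>_ i k. y i * cnj (y k) / of_real q"]) simp
next
  case (add M N)
  from add.IH(1) obtain r p A B where
    1: "\<forall>t<(r::nat). 0 \<le> p t \<and> density_matrix a (A t) \<and> density_matrix b (B t)"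
    "\<forall>i<a. \<forall>j<b. \<forall>k<a. \<forall>l<b. M (i, j) (k, l) = (\<Sum>t<r. of_real (p t) * A t i k * B t j l)"
    by blast
  from add.IH(2) obtain r' p' A' B' where
    2: "\<forall>t<(r'::nat). 0 \<le> p' t \<and> density_matrix a (A' t) \<and> density_matrix b (B' t)"
    "\<forall>i<a. \<forall>j<b. \<forall>k<a. \<forall>l<b. N (i, j) (k, l) = (\<Sum>t<r'. of_real (p' t) * A' t i k * B' t j l)"
    by blast
  \<comment> \<open>Two decompositions are concatenated; the second one starts at index
    \<open>r\<close>.\<close>
  have split: "(\<Sum>t<r + r'. if t < r then f t else g (t - r)) = sum f {..<r} + sum g {..<r'}"
    for f g :: "nat \<Rightarrow> complex"
    by (induction r') (simp_all add: add.assoc)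
  show ?case
  proof (intro exI conjI allI impI)
    fix i j k l assume "i < a" "j < b" "k < a" "l < b"
    then have "M (i, j) (k, l) + N (i, j) (k, l) = (\<Sum>t<r + r'. if t < r
        then of_real (p t) * A t i k * B t j l
        else of_real (p' (t - r)) * A' (t - r) i k * B' (t - r) j l)"
      using 1(2) 2(2) split[of "\<lambda>t. of_real (p t) * A t i k * B t j l"
          "\<lambda>t. of_real (p' t) * A' t i k * B' t j l"] by simp
    also have "\<dots> = (\<Sum>t<r + r'. of_real (if t < r then p t else p' (t - r)) *
        (if t < r then A t else A' (t - r)) i k * (if t < r then B t else B' (t - r)) j l)"
      by (intro sum.cong) auto
    finally show "M (i, j) (k, l) + N (i, j) (k, l) = \<dots>" .
  qed (use 1(1) 2(1) in \<open>auto simp: less_diff_conv2\<close>)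
qed

text \<open>All factors of a cone decomposition have trace 1, so the trace of \<open>M\<close> is
  the sum of the weights; trace one makes the combination convex.\<close>

lemma separable_of_product_cone:
  assumes "product_cone a b M" and "(\<Sum>u\<in>grid a b. M u u) = 1"
  shows "separable a b M"
proof -
  obtain r p A B where
    dm: "\<forall>t<(r::nat). 0 \<le> p t \<and> density_matrix a (A t) \<and> density_matrix b (B t)" and
    M: "\<forall>i<a. \<forall>j<b. \<forall>k<a. \<forall>l<b. M (i, j) (k, l) = (\<Sum>t<r. of_real (p t) * A t i k * B t j l)"
    using product_cone_decomposition[OF assms(1)] by blast
  have "1 = (\<Sum>i<a. \<Sum>j<b. M (i, j) (i, j))"
    using assms(2) sum_grid[of "\<lambda>u. M u u"] by simp
  also have "\<dots> = (\<Sum>i<a. \<Sum>j<b. \<Sum>t<r. of_real (p t) * A t i i * B t j j)"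
    using M by (intro sum.cong) auto
  also have "\<dots> = (\<Sum>i<a. \<Sum>t<r. \<Sum>j<b. of_real (p t) * A t i i * B t j j)"
    by (intro sum.cong refl sum.swap)
  also have "\<dots> = (\<Sum>t<r. \<Sum>i<a. \<Sum>j<b. of_real (p t) * A t i i * B t j j)"
    by (rule sum.swap)
  also have "\<dots> = (\<Sum>t<r. of_real (p t) * (\<Sum>i<a. A t i i) * (\<Sum>j<b. B t j j))"
    by (simp only: sum_product mult.assoc) (simp only: sum_distrib_left)
  also have "\<dots> = (\<Sum>t<r. of_real (p t))"
    using dm density_matrix_trace by (intro sum.cong) auto
  also have "\<dots> = of_real (\<Sum>t<r. p t)"
    by simp
  finally have "(\<Sum>t<r. p t) = 1"
    by (metis of_real_eq_1_iff)
  then show ?thesis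
    unfolding separable_def using dm M by blast
qed

text \<open>Exchanging the tensor factors turns rows into columns, so vertical edges and the column
  configuration follow from their row counterparts.\<close>

lemma product_cone_swap:
  assumes "product_cone a b M"
  shows "product_cone b a (\<lambda>u v. M (prod.swap u) (prod.swap v))"
  using assms
proof induction
  case zero
  then show ?case by (rule product_cone.zero)
next
  case (vectors w x y)
  then have "product_cone b a (\<lambda>u v. complex_of_real w * (y (fst u) * cnj (y (fst v))) *
      (x (snd u) * cnj (x (snd v))))"
    by (intro product_cone.vectors[where w = w and x = y and y = x])
  then show ?case by (simp add: mult_ac)
next
  case (add M N)
  then show ?case using product_cone.add[OF add.IH] by simp
qed

section \<open>Edge Laplacians inside the cone\<close>

lemma edge_laplacian_swap:
  "edge_laplacian {(i, j), (k, l)} (prod.swap u) (prod.swap v) = edge_laplacian {(j, i), (l, k)} u v"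
proof -
  have "prod.swap w \<in> {(i, j), (k, l)} \<longleftrightarrow> w \<in> {(j, i), (l, k)}" for w
    by (cases w) auto
  moreover have "prod.swap u = prod.swap v \<longleftrightarrow> u = v"
    by (cases u; cases v) auto
  ultimately show ?thesis
    unfolding edge_laplacian_def by (simp only:)
qed

text \<open>The Laplacian of an edge is the outer square of the difference of its two basis vectors.
  In coordinates this gives polynomials in indicators, suited to algebraic simplification.\<close>

lemma edge_laplacian_eq:
  assumes "(i, j) \<noteq> (k, l)"
  shows "edge_laplacian {(i, j), (k, l)} (p, q) (r, s) =
    (of_bool (p = i) * of_bool (q = j) - of_bool (p = k) * of_bool (q = l)) *
    (of_bool (r = i) * of_bool (s = j) - of_bool (r = k) * of_bool (s = l))"
proof -
  have "edge_laplacian {a, b} u v =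
      (of_bool (u = a) - of_bool (u = b)) * (of_bool (v = a) - of_bool (v = b))" if "a \<noteq> b" for a b u v
    using that by (auto simp: edge_laplacian_def)
  from this[OF assms] show ?thesis
    by (simp only: prod.inject of_bool_conj)
qed

text \<open>The difference of the endpoint vectors is itself a product: \<open>|i>\<close> tensor
  \<open>|j> - |l>\<close>.\<close>

lemma product_cone_horizontal_edge:
  assumes "i < a" "j < b" "j \<noteq> l"
  shows "product_cone a b (edge_laplacian {(i, j), (i, l)})"
proof -
  define x y :: "nat \<Rightarrow> complex" where "x = (\<lambda>p. of_bool (p = i))"
    and "y = (\<lambda>q. of_bool (q = j) - of_bool (q = l))"
  have "product_cone a b (\<lambda>u v. complex_of_real 1 * (x (fst u) * cnj (x (fst v))) *
      (y (snd u) * cnj (y (snd v))))"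
    by (rule product_cone.vectors) (use assms in \<open>auto simp: x_def y_def\<close>)
  also have "\<dots> = edge_laplacian {(i, j), (i, l)}"
  proof (intro ext)
    fix u v
    show "complex_of_real 1 * (x (fst u) * cnj (x (fst v))) * (y (snd u) * cnj (y (snd v))) =
        edge_laplacian {(i, j), (i, l)} u v"
      using assms(3) by (cases u; cases v) (simp add: edge_laplacian_eq x_def y_def)
  qed
  finally show ?thesis .
qed

lemma product_cone_non_diagonal_edge:
  assumes "grid_graph a b E" and "e \<in> E" and "\<not> diagonal e"
  shows "product_cone a b (edge_laplacian e)"
proof -
  obtain i j k l where e: "e = {(i, j), (k, l)}" "(i, j) \<noteq> (k, l)" "i < a" "k < a" "j < b" "l < b"
    using grid_graph_edgeE[OF assms(1,2)] by metis
  have "i = k \<or> j = l"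
    using assms(3) e(1) unfolding diagonal_def by blast
  then show ?thesis
  proof
    assume "i = k"
    then show ?thesis
      using e product_cone_horizontal_edge by simp
  next
    assume "j = l"
    then have "product_cone b a (edge_laplacian {(j, i), (l, k)})"
      using e product_cone_horizontal_edge by simp
    from product_cone_swap[OF this] show ?thesis
      by (simp add: edge_laplacian_swap e(1))
  qed
qed

lemma separable_rho_of_diagonal_edges:
  assumes "grid_graph a b E" and "E \<noteq> {}"
    and "product_cone a b (\<lambda>u v. \<Sum>e\<in>diagonal_edges E. edge_laplacian e u v)"
  shows "separable a b (rho E)"
proof (rule separable_of_product_cone)
  show "(\<Sum>u\<in>grid a b. rho E u u) = 1"
    using assms(1,2) by (rule trace_rho)
next
  have fin: "finite E"
    using grid_graph_finite[OF assms(1)] .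
  have "product_cone a b (\<lambda>u v. \<Sum>e\<in>{e \<in> E. \<not> diagonal e}. edge_laplacian e u v)"
    using fin product_cone_non_diagonal_edge[OF assms(1)] by (intro product_cone_sum) auto
  from product_cone_scale[OF product_cone.add[OF this assms(3)], of "1 / (2 * card E)"]
  have "product_cone a b (\<lambda>u v. complex_of_real (1 / (2 * card E)) *
      ((\<Sum>e\<in>{e \<in> E. \<not> diagonal e}. edge_laplacian e u v) +
       (\<Sum>e\<in>diagonal_edges E. edge_laplacian e u v)))"
    by simp
  also have "(\<lambda>u v. complex_of_real (1 / (2 * card E)) *
      ((\<Sum>e\<in>{e \<in> E. \<not> diagonal e}. edge_laplacian e u v) +
       (\<Sum>e\<in>diagonal_edges E. edge_laplacian e u v))) = rho E"
  proof (intro ext)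
    fix u v
    have "E = {e \<in> E. \<not> diagonal e} \<union> diagonal_edges E"
      by (auto simp: diagonal_edges_eq)
    moreover have "{e \<in> E. \<not> diagonal e} \<inter> diagonal_edges E = {}"
      by (auto simp: diagonal_edges_eq)
    ultimately have "(\<Sum>e\<in>E. edge_laplacian e u v) =
        (\<Sum>e\<in>{e \<in> E. \<not> diagonal e}. edge_laplacian e u v) +
        (\<Sum>e\<in>diagonal_edges E. edge_laplacian e u v)"
      using fin by (metis (lifting) finite_Un sum.union_disjoint)
    then show "complex_of_real (1 / (2 * card E)) *
      ((\<Sum>e\<in>{e \<in> E. \<not> diagonal e}. edge_laplacian e u v) +
       (\<Sum>e\<in>diagonal_edges E. edge_laplacian e u v)) = rho E u v"
      by (simp add: rho_def laplacian_eq_sum_edges[OF assms(1)])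
  qed
  finally show "product_cone a b (rho E)" .
qed

text \<open>For \<open>z = 1\<close> and \<open>z = -1\<close>, the vector
  \<open>(|i> - z |k>)\<close> tensor \<open>(|j> + z |l>)\<close> equals
  \<open>(|ij> - |kl>) + z (|il> - |kj>)\<close>. Averaging the two outer squares cancels the mixed
  terms and leaves the two edges.\<close>

lemma product_cone_crossing_pair:
  assumes "i < a" "k < a" "j < b" "l < b" "i \<noteq> k" "j \<noteq> l"
  shows "product_cone a b
    (\<lambda>u v. edge_laplacian {(i, j), (k, l)} u v + edge_laplacian {(i, l), (k, j)} u v)"
proof -
  define x y :: "complex \<Rightarrow> nat \<Rightarrow> complex"
    where "x = (\<lambda>z p. of_bool (p = i) - z * of_bool (p = k))"
      and "y = (\<lambda>z q. of_bool (q = j) + z * of_bool (q = l))"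
  define P where "P = (\<lambda>z u v. complex_of_real (1/2) * (x z (fst u) * cnj (x z (fst v))) *
      (y z (snd u) * cnj (y z (snd v))))"
  have "product_cone a b (P z)" for z
    unfolding P_def
    by (rule product_cone.vectors) (use assms in \<open>auto simp: x_def y_def\<close>)
  then have "product_cone a b (\<lambda>u v. P 1 u v + P (-1) u v)"
    by (intro product_cone.add)
  also have "\<dots> = (\<lambda>u v. edge_laplacian {(i, j), (k, l)} u v + edge_laplacian {(i, l), (k, j)} u v)"
  proof (intro ext)
    fix u v
    show "P 1 u v + P (-1) u v =
        edge_laplacian {(i, j), (k, l)} u v + edge_laplacian {(i, l), (k, j)} u v"
      using assms(5,6)
      by (cases u; cases v) (simp add: P_def x_def y_def edge_laplacian_eq field_simps)
  qed
  finally show ?thesis .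
qed

text \<open>Primed variables play the role of conjugates. Since \<open>w'\<close> is the square of
  \<open>w\<close>, the unprimed half of \<open>F z z'\<close> is the sum of the three edge
  differences with coefficients \<open>1\<close>, \<open>z\<close>, \<open>z'\<close>; orthogonality
  of the characters of Z/3 removes the mixed products.\<close>

lemma fourier_identity_3:
  fixes w w' X1 X2 X1' X2' Y1 Y2 Y3 Y1' Y2' Y3' :: "'a::field_char_0"
  assumes "w * w' = 1" and "1 + w + w' = 0"
  defines "F \<equiv> \<lambda>z z'. (X1 - z' * X2) * (X1' - z * X2') *
    ((Y1 + z * Y2 + z' * Y3) * (Y1' + z' * Y2' + z * Y3'))"
  shows "F 1 1 + F w w' + F w' w = 3 * ((X1 * Y1 - X2 * Y2) * (X1' * Y1' - X2' * Y2') +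
    (X1 * Y2 - X2 * Y3) * (X1' * Y2' - X2' * Y3') + (X1 * Y3 - X2 * Y1) * (X1' * Y3' - X2' * Y1'))"
proof -
  \<comment> \<open>Eliminating \<open>w'\<close> leaves one variable with a quadratic relation,
    modulo which the claim is a polynomial identity.\<close>
  have w': "w' = - 1 - w"
    using assms(2) by algebra
  have "w * w = - 1 - w"
    using assms(1) unfolding w' by algebra
  then show ?thesis
    unfolding F_def w' by algebra
qed

text \<open>The eigenvectors of the cyclic shift are \<open>(1, z, z\<^sup>2)\<close> with \<open>z\<close> a cube root of unity, and in
  this basis the Laplacian of the three edges is block diagonal with blocks of rank one.\<close>

lemma product_cone_crossing_triple:
  assumes "i < a" "k < a" "j1 < b" "j2 < b" "j3 < b" "i \<noteq> k" "j1 \<noteq> j2" "j1 \<noteq> j3" "j2 \<noteq> j3"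
  shows "product_cone a b (\<lambda>u v. edge_laplacian {(i, j1), (k, j2)} u v +
    edge_laplacian {(i, j2), (k, j3)} u v + edge_laplacian {(i, j3), (k, j1)} u v)"
proof -
  \<comment> \<open>A primitive cube root of unity, with \<open>cnj \<omega>\<close> as its
    square.\<close>
  define \<omega> where "\<omega> = Complex (-1/2) (sqrt 3 / 2)"
  have \<omega>: "\<omega> * cnj \<omega> = 1" "1 + \<omega> + cnj \<omega> = 0"
    by (simp_all add: \<omega>_def complex_eq_iff)
  define x y :: "complex \<Rightarrow> nat \<Rightarrow> complex"
    where "x = (\<lambda>z p. of_bool (p = i) - cnj z * of_bool (p = k))"
      and "y = (\<lambda>z q. of_bool (q = j1) + z * of_bool (q = j2) + cnj z * of_bool (q = j3))"
  define P where "P = (\<lambda>z u v. complex_of_real (1/3) * (x z (fst u) * cnj (x z (fst v))) *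
      (y z (snd u) * cnj (y z (snd v))))"
  have "product_cone a b (P z)" for z
    unfolding P_def
    by (rule product_cone.vectors) (use assms in \<open>auto simp: x_def y_def\<close>)
  then have "product_cone a b (\<lambda>u v. P 1 u v + P \<omega> u v + P (cnj \<omega>) u v)"
    by (intro product_cone.add)
  also have "\<dots> = (\<lambda>u v. edge_laplacian {(i, j1), (k, j2)} u v +
    edge_laplacian {(i, j2), (k, j3)} u v + edge_laplacian {(i, j3), (k, j1)} u v)"
  proof (intro ext)
    fix u v :: "nat \<times> nat"
    obtain p q r s where uv: "u = (p, q)" "v = (r, s)"
      by (metis surj_pair)
    have cnj_of_bool: "cnj (of_bool \<phi>) = of_bool \<phi>" for \<phi>
      by (cases \<phi>) simp_all
    \<comment> \<open>The factor 3 clears the weight 1/3; the indicators stay unsplit so that they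
      match the variables of \<open>fourier_identity_3\<close>.\<close>
    have "3 * P z u v =
        (of_bool (p = i) - cnj z * of_bool (p = k)) * (of_bool (r = i) - z * of_bool (r = k)) *
        ((of_bool (q = j1) + z * of_bool (q = j2) + cnj z * of_bool (q = j3)) *
         (of_bool (s = j1) + cnj z * of_bool (s = j2) + z * of_bool (s = j3)))" for z
      by (simp add: uv P_def x_def y_def cnj_of_bool del: of_bool_eq_iff split del: if_split split_of_bool)
    then have "3 * (P 1 u v + P \<omega> u v + P (cnj \<omega>) u v) = 3 * (edge_laplacian {(i, j1), (k, j2)} u v +
        edge_laplacian {(i, j2), (k, j3)} u v + edge_laplacian {(i, j3), (k, j1)} u v)"
      using fourier_identity_3[OF \<omega>, of "of_bool (p = i)" "of_bool (p = k)" "of_bool (r = i)"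
          "of_bool (r = k)" "of_bool (q = j1)" "of_bool (q = j2)" "of_bool (q = j3)"
          "of_bool (s = j1)" "of_bool (s = j2)" "of_bool (s = j3)"] assms(6)
      by (simp only: distrib_left[of 3] uv edge_laplacian_eq complex_cnj_cnj complex_cnj_one
          prod.inject simp_thms)
    then show "P 1 u v + P \<omega> u v + P (cnj \<omega>) u v = edge_laplacian {(i, j1), (k, j2)} u v +
        edge_laplacian {(i, j2), (k, j3)} u v + edge_laplacian {(i, j3), (k, j1)} u v"
      by (simp only: mult_cancel_left) simp
  qed
  finally show ?thesis .
qed

section \<open>The degree criterion\<close>

text \<open>The sum of all entries is the value of the form at the all-ones vector, and it is real
  because the matrix is Hermitian.\<close>

lemma density_matrix_sum_nonneg:
  assumes "density_matrix d A"
  shows "0 \<le> Re (\<Sum>i<d. \<Sum>j<d. A i j)" and "Im (\<Sum>i<d. \<Sum>j<d. A i j) = 0"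
proof -
  have "0 \<le> Re (\<Sum>i<d. \<Sum>j<d. cnj 1 * A i j * 1)"
    using assms unfolding density_matrix_def by (elim conjE allE[of _ "\<lambda>_. 1"])
  then show "0 \<le> Re (\<Sum>i<d. \<Sum>j<d. A i j)"
    by simp
  have "cnj (\<Sum>i<d. \<Sum>j<d. A i j) = (\<Sum>i<d. \<Sum>j<d. A j i)"
    unfolding cnj_sum by (intro sum.cong refl density_matrix_hermitian[OF assms, symmetric]) auto
  also have "\<dots> = (\<Sum>i<d. \<Sum>j<d. A i j)"
    by (rule sum.swap)
  finally show "Im (\<Sum>i<d. \<Sum>j<d. A i j) = 0"
    by (metis Reals_cnj_iff complex_is_Real_iff)
qed

text \<open>A positive semidefinite form that vanishes at the all-ones vector has it in its kernel: otherwise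
  it would be negative at a small perturbation in the \<open>i\<close>-th coordinate.\<close>

lemma density_matrix_row_sum_zero:
  assumes A: "density_matrix d A" and zero: "(\<Sum>i<d. \<Sum>j<d. A i j) = 0" and "i < d"
  shows "(\<Sum>j<d. A i j) = 0"
proof (rule ccontr)
  define R where "R = (\<lambda>i. \<Sum>j<d. A i j)"
  assume "(\<Sum>j<d. A i j) \<noteq> 0"
  then have R: "(cmod (R i))\<^sup>2 > 0"
    by (simp add: R_def)
  \<comment> \<open>The form is expanded at \<open>s\<close> times the all-ones vector plus
    \<open>c\<close> in coordinate \<open>i\<close>. The pure \<open>s\<close> term vanishes by
    \<open>zero\<close>, and the column sum is the conjugate of the row sum.\<close>
  have form: "(\<Sum>p<d. \<Sum>q<d. cnj (s + (if p = i then c else 0)) * A p q * (s + (if q = i then c else 0))) =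
      cnj s * c * cnj (R i) + cnj c * s * R i + cnj c * c * A i i" for c s
  proof -
    have "(\<Sum>p<d. \<Sum>q<d. cnj (s + (if p = i then c else 0)) * A p q * (s + (if q = i then c else 0))) =
        (\<Sum>p<d. cnj (s + (if p = i then c else 0)) * (s * R p + A p i * c))"
    proof (rule sum.cong[OF refl])
      fix p
      have "(\<Sum>q<d. A p q * (s + (if q = i then c else 0))) =
          (\<Sum>q<d. s * A p q + (if q = i then A p i * c else 0))"
        by (intro sum.cong) (auto simp: algebra_simps)
      also have "\<dots> = s * R p + A p i * c"
        using \<open>i < d\<close> by (simp add: R_def sum.distrib flip: sum_distrib_left)
      finally show "(\<Sum>q<d. cnj (s + (if p = i then c else 0)) * A p q * (s + (if q = i then c else 0))) =
          cnj (s + (if p = i then c else 0)) * (s * R p + A p i * c)"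
        by (simp only: mult.assoc flip: sum_distrib_left)
    qed
    also have "\<dots> = (\<Sum>p<d. cnj s * s * R p) + (\<Sum>p<d. cnj s * c * A p i) +
        (\<Sum>p<d. if p = i then cnj c * (s * R i + A i i * c) else 0)"
      unfolding sum.distrib[symmetric] by (intro sum.cong) (auto simp: algebra_simps)
    also have "(\<Sum>p<d. cnj s * s * R p) = 0"
      using zero unfolding R_def sum_distrib_left[symmetric] by simp
    also have "(\<Sum>p<d. cnj s * c * A p i) = cnj s * c * cnj (R i)"
      unfolding R_def cnj_sum sum_distrib_left using \<open>i < d\<close>
      by (intro sum.cong refl arg_cong2[where f = "(*)"] density_matrix_hermitian[OF A]) auto
    finally show ?thesis
      using \<open>i < d\<close> by (simp add: algebra_simps)
  qed
  have nonneg: "0 \<le> Re (cnj s * c * cnj (R i) + cnj c * s * R i + cnj c * c * A i i)" for c s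
    using A unfolding form[symmetric] density_matrix_def
    by (elim conjE allE[of _ "\<lambda>p. s + (if p = i then c else 0)"])
  define \<alpha> where "\<alpha> = Re (A i i)"
  have \<alpha>: "0 \<le> \<alpha>"
    using nonneg[of 0 1] by (simp add: \<alpha>_def)
  \<comment> \<open>This choice gives \<open>\<epsilon> * \<alpha> < 1\<close>, so the linear
    decrease outweighs the quadratic term; \<open>\<alpha> + 1\<close> avoids division by
    zero.\<close>
  define \<epsilon> where "\<epsilon> = 1 / (\<alpha> + 1)"
  \<comment> \<open>Moving against the row sum, \<open>c = - \<epsilon> R i\<close>, makes both
    cross terms equal to minus \<open>\<epsilon>\<close> times the squared modulus of
    \<open>R i\<close>.\<close>
  have "0 \<le> Re (- of_real \<epsilon> * (R i * cnj (R i)) - of_real \<epsilon> * (R i * cnj (R i)) +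
      of_real (\<epsilon>\<^sup>2) * (R i * cnj (R i)) * A i i)"
    using nonneg[of 1 "- of_real \<epsilon> * R i"] by (simp add: power2_eq_square mult_ac)
  also have "\<dots> = (cmod (R i))\<^sup>2 * \<epsilon> * (\<epsilon> * \<alpha> - 2)"
    unfolding complex_norm_square[symmetric] of_real_mult[symmetric] \<alpha>_def
    by (simp add: algebra_simps power2_eq_square)
  finally have "0 \<le> (cmod (R i))\<^sup>2 * \<epsilon> * (\<epsilon> * \<alpha> - 2)" .
  moreover have "\<epsilon> > 0" "\<epsilon> * \<alpha> < 2"
    using \<alpha> by (auto simp: \<epsilon>_def field_simps)
  then have "(cmod (R i))\<^sup>2 * \<epsilon> * (\<epsilon> * \<alpha> - 2) < 0"
    using R by (intro mult_pos_neg mult_pos_pos) auto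
  ultimately show False
    by simp
qed

text \<open>\<open>\<rho> (i, l) (k, j)\<close> is the entry of the partial transpose at
  \<open>(i, j)\<close>, \<open>(k, l)\<close>. Its total sum splits into nonnegative terms, one per
  product state, so a vanishing total makes every term vanish, and with it each row sum.\<close>

lemma separable_partial_transpose_kernel:
  assumes "separable a b \<rho>"
    and zero: "(\<Sum>i<a. \<Sum>j<b. \<Sum>k<a. \<Sum>l<b. \<rho> (i, l) (k, j)) = 0"
    and "i < a" "j < b"
  shows "(\<Sum>k<a. \<Sum>l<b. \<rho> (i, l) (k, j)) = 0"
proof -
  obtain r p A B where
    pAB: "\<forall>t<(r::nat). 0 \<le> p t \<and> density_matrix a (A t) \<and> density_matrix b (B t)" and
    \<rho>: "\<forall>i<a. \<forall>j<b. \<forall>k<a. \<forall>l<b. \<rho> (i, j) (k, l) = (\<Sum>t<r. of_real (p t) * A t i k * B t j l)"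
    using assms(1) unfolding separable_def by (elim exE conjE)
  from pAB have dm: "\<And>t. t < r \<Longrightarrow> 0 \<le> p t" "\<And>t. t < r \<Longrightarrow> density_matrix a (A t)"
    "\<And>t. t < r \<Longrightarrow> density_matrix b (B t)"
    by auto
  have row: "(\<Sum>k<a. \<Sum>l<b. \<rho> (i, l) (k, j)) =
      (\<Sum>t<r. of_real (p t) * ((\<Sum>k<a. A t i k) * (\<Sum>l<b. B t l j)))" if "i < a" "j < b" for i j
  proof -
    have "(\<Sum>k<a. \<Sum>l<b. \<rho> (i, l) (k, j)) = (\<Sum>k<a. \<Sum>l<b. \<Sum>t<r. of_real (p t) * A t i k * B t l j)"
      using \<rho> that by (intro sum.cong) auto
    also have "\<dots> = (\<Sum>k<a. \<Sum>t<r. \<Sum>l<b. of_real (p t) * A t i k * B t l j)"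
      by (intro sum.cong refl sum.swap)
    also have "\<dots> = (\<Sum>t<r. \<Sum>k<a. \<Sum>l<b. of_real (p t) * A t i k * B t l j)"
      by (rule sum.swap)
    finally show ?thesis
      by (simp only: sum_product mult.assoc) (simp only: sum_distrib_left)
  qed
  define SA SB where "SA = (\<lambda>t. \<Sum>i<a. \<Sum>k<a. A t i k)" and "SB = (\<lambda>t. \<Sum>j<b. \<Sum>l<b. B t j l)"
  have "0 = (\<Sum>i<a. \<Sum>j<b. \<Sum>t<r. of_real (p t) * ((\<Sum>k<a. A t i k) * (\<Sum>l<b. B t l j)))"
    unfolding zero[symmetric] by (rule sum.cong[OF refl], rule sum.cong[OF refl], rule row) auto
  also have "\<dots> = (\<Sum>i<a. \<Sum>t<r. \<Sum>j<b. of_real (p t) * ((\<Sum>k<a. A t i k) * (\<Sum>l<b. B t l j)))"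
    by (intro sum.cong refl sum.swap)
  also have "\<dots> = (\<Sum>t<r. \<Sum>i<a. \<Sum>j<b. of_real (p t) * ((\<Sum>k<a. A t i k) * (\<Sum>l<b. B t l j)))"
    by (rule sum.swap)
  also have "\<dots> = (\<Sum>t<r. of_real (p t) * (SA t * (\<Sum>j<b. \<Sum>l<b. B t l j)))"
    unfolding SA_def sum_product[of "\<lambda>i. \<Sum>k<a. A _ i k"] by (simp only: sum_distrib_left)
  also have "\<dots> = (\<Sum>t<r. of_real (p t * (Re (SA t) * Re (SB t))))"
  proof (intro sum.cong refl)
    fix t assume "t \<in> {..<r}"
    then have "SA t = of_real (Re (SA t))" "SB t = of_real (Re (SB t))"
      using density_matrix_sum_nonneg(2) dm(2,3) by (simp_all add: SA_def SB_def complex_eq_iff)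
    moreover have "(\<Sum>j<b. \<Sum>l<b. B t l j) = SB t"
      unfolding SB_def by (rule sum.swap)
    ultimately show "of_real (p t) * (SA t * (\<Sum>j<b. \<Sum>l<b. B t l j)) =
        of_real (p t * (Re (SA t) * Re (SB t)))"
      by (metis of_real_mult)
  qed
  finally have "(\<Sum>t<r. p t * (Re (SA t) * Re (SB t))) = 0"
    by (metis of_real_eq_0_iff of_real_sum)
  moreover have "0 \<le> p t * (Re (SA t) * Re (SB t))" if "t \<in> {..<r}" for t
    using that dm density_matrix_sum_nonneg(1) by (simp add: SA_def SB_def)
  ultimately have terms: "p t * (Re (SA t) * Re (SB t)) = 0" if "t < r" for t
    using that by (subst (asm) sum_nonneg_eq_0_iff) auto
  have "of_real (p t) * ((\<Sum>k<a. A t i k) * (\<Sum>l<b. B t l j)) = 0" if tr: "t < r" for t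
  proof -
    consider "p t = 0" | "Re (SA t) = 0" | "Re (SB t) = 0"
      using terms[OF tr] by auto
    then show ?thesis
    proof cases
      case 2
      then have "SA t = 0"
        using density_matrix_sum_nonneg(2)[OF dm(2)[OF tr]] by (simp add: SA_def complex_eq_iff)
      then have "(\<Sum>k<a. A t i k) = 0"
        using density_matrix_row_sum_zero dm(2) tr \<open>i < a\<close> by (simp add: SA_def)
      then show ?thesis by simp
    next
      case 3
      then have "SB t = 0"
        using density_matrix_sum_nonneg(2)[OF dm(3)[OF tr]] by (simp add: SB_def complex_eq_iff)
      then have "(\<Sum>l<b. B t j l) = 0"
        using density_matrix_row_sum_zero dm(3) tr \<open>j < b\<close> by (simp add: SB_def)
      \<comment> \<open>Transposing the second factor produces column sums of \<open>B t\<close>,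
        which are conjugates of its row sums.\<close>
      moreover have "(\<Sum>l<b. B t l j) = cnj (\<Sum>l<b. B t j l)"
        unfolding cnj_sum using \<open>j < b\<close>
        by (intro sum.cong refl density_matrix_hermitian[OF dm(3)[OF tr]]) auto
      ultimately show ?thesis by simp
    qed simp
  qed
  then show ?thesis
    unfolding row[OF assms(3,4)] by (intro sum.neutral) blast
qed

section \<open>Incidence counts from the partially transposed Laplacian\<close>

text \<open>The rank-one form separates the sums over \<open>k\<close> and \<open>l\<close>. The
  product is 1 at the ends of a diagonal edge, -1 at the opposite corners, and identically 0 for
  other edges.\<close>

lemma edge_laplacian_partial_transpose_row_sum:
  assumes "(p, q) \<noteq> (r, s)" "p < a" "r < a" "q < b" "s < b"
  shows "(\<Sum>k<a. \<Sum>l<b. edge_laplacian {(p, q), (r, s)} (i, l) (k, j)) =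
    (of_bool (i = p) - of_bool (i = r)) * (of_bool (j = q) - of_bool (j = s))"
proof -
  have "(\<Sum>k<a. \<Sum>l<b. edge_laplacian {(p, q), (r, s)} (i, l) (k, j)) =
      (\<Sum>k<a. of_bool (k = p) * of_bool (j = q) - of_bool (k = r) * of_bool (j = s)) *
      (\<Sum>l<b. of_bool (i = p) * of_bool (l = q) - of_bool (i = r) * of_bool (l = s))"
    unfolding sum_product edge_laplacian_eq[OF assms(1)] by (simp add: mult.commute)
  also have "\<dots> = (of_bool (j = q) - of_bool (j = s)) * (of_bool (i = p) - of_bool (i = r))"
    using assms by (simp add: sum_subtractf of_bool_def if_distrib[of "\<lambda>x. x * _"]
        if_distrib[of "\<lambda>x. _ * x"] cong: if_cong)
  finally show ?thesis
    by (simp only: mult.commute)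
qed

lemma opposite_diagonal:
  assumes "i \<noteq> k" "j \<noteq> l"
  shows "opposite {(i, j), (k, l)} = {(i, l), (k, j)}"
  using assms by (auto simp: opposite_def)

lemma degree_criterion:
  assumes G: "grid_graph a b E" and "E \<noteq> {}" and sep: "separable a b (rho E)"
  shows "(\<Sum>e\<in>diagonal_edges E. of_bool (v \<in> e)) =
    (\<Sum>e\<in>diagonal_edges E. of_bool (v \<in> opposite e) :: nat)"
proof (cases "v \<in> grid a b")
  \<comment> \<open>Opposite corners of an edge stay in the grid, so off the grid both counts are
    zero; this allows an unrestricted \<open>v\<close> later.\<close>
  case False
  have "v \<notin> e \<and> v \<notin> opposite e" if "e \<in> E" for e
    using False grid_graph_edge_subset[OF G that] by (force simp: opposite_def grid_def)
  then show ?thesis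
    by (simp add: diagonal_edges_eq)
next
  case True
  then obtain i j where v: "v = (i, j)" "i < a" "j < b"
    by (auto simp: grid_def)
  define g where "g = (\<lambda>e i j. \<Sum>k<a. \<Sum>l<b. edge_laplacian e (i, l) (k, j))"
  have fin: "finite E"
    using grid_graph_finite[OF G] .
  have row: "(\<Sum>k<a. \<Sum>l<b. rho E (i, l) (k, j)) = (\<Sum>e\<in>E. g e i j) / of_nat (2 * card E)" for i j
  proof -
    have "(\<Sum>k<a. \<Sum>l<b. \<Sum>e\<in>E. edge_laplacian e (i, l) (k, j)) =
        (\<Sum>k<a. \<Sum>e\<in>E. \<Sum>l<b. edge_laplacian e (i, l) (k, j))"
      by (intro sum.cong refl sum.swap)
    also have "\<dots> = (\<Sum>e\<in>E. g e i j)"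
      unfolding g_def by (rule sum.swap)
    finally show ?thesis
      by (simp add: rho_def laplacian_eq_sum_edges[OF G] flip: sum_divide_distrib)
  qed
  have g: "g e i j = (if diagonal e then of_bool ((i, j) \<in> e) - of_bool ((i, j) \<in> opposite e) else 0)"
    and total: "(\<Sum>i<a. \<Sum>j<b. g e i j) = 0" if eE: "e \<in> E" for e i j
  proof -
    obtain p q r s where e: "e = {(p, q), (r, s)}" "(p, q) \<noteq> (r, s)" "p < a" "r < a" "q < b" "s < b"
      using grid_graph_edgeE[OF G eE] by metis
    have ge: "g e i j = (of_bool (i = p) - of_bool (i = r)) * (of_bool (j = q) - of_bool (j = s))" for i j
      unfolding g_def e(1) using e by (intro edge_laplacian_partial_transpose_row_sum)
    have "diagonal e \<longleftrightarrow> p \<noteq> r \<and> q \<noteq> s"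
      unfolding e(1) diagonal_def by (auto simp: doubleton_eq_iff)
    then show "g e i j = (if diagonal e then of_bool ((i, j) \<in> e) - of_bool ((i, j) \<in> opposite e) else 0)"
      unfolding ge by (auto simp: e(1) opposite_diagonal)
    \<comment> \<open>Each factor sums to zero because its two indicators both fall inside the
      range.\<close>
    have "(\<Sum>i<a. \<Sum>j<b. g e i j) =
        (\<Sum>i<a. of_bool (i = p) - of_bool (i = r)) * (\<Sum>j<b. of_bool (j = q) - of_bool (j = s))"
      unfolding ge sum_product ..
    also have "\<dots> = 0"
      using e by (simp add: sum_subtractf of_bool_def)
    finally show "(\<Sum>i<a. \<Sum>j<b. g e i j) = 0" .
  qed
  have "(\<Sum>i<a. \<Sum>j<b. \<Sum>e\<in>E. g e i j) = (\<Sum>i<a. \<Sum>e\<in>E. \<Sum>j<b. g e i j)"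
    by (intro sum.cong refl sum.swap)
  also have "\<dots> = (\<Sum>e\<in>E. \<Sum>i<a. \<Sum>j<b. g e i j)"
    by (rule sum.swap)
  also have "\<dots> = 0"
    using total by simp
  finally have "(\<Sum>i<a. \<Sum>j<b. \<Sum>k<a. \<Sum>l<b. rho E (i, l) (k, j)) = 0"
    unfolding row by (simp flip: sum_divide_distrib)
  from separable_partial_transpose_kernel[OF sep this v(2,3)]
  have "(\<Sum>e\<in>E. g e i j) = 0"
    using fin \<open>E \<noteq> {}\<close> unfolding row by simp
  then have "(\<Sum>e\<in>diagonal_edges E. of_bool (v \<in> e) - of_bool (v \<in> opposite e)) = (0::complex)"
    using fin by (simp add: g diagonal_edges_eq v(1) sum.inter_filter)
  then have "of_nat (\<Sum>e\<in>diagonal_edges E. of_bool (v \<in> e)) =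
      (of_nat (\<Sum>e\<in>diagonal_edges E. of_bool (v \<in> opposite e)) :: complex)"
    by (simp add: sum_subtractf)
  then show ?thesis
    by (simp only: of_nat_eq_iff)
qed

section \<open>Graphs with few diagonal edges satisfying the degree criterion\<close>

text \<open>One opposite corner fixes a diagonal edge up to the coordinates \<open>x\<close>,
  \<open>y\<close> of the antipodal corner; these are the unknowns in the case analyses
  below.\<close>

lemma opposite_vertexE:
  assumes "diagonal e" and "(i, j) \<in> opposite e"
  obtains x y where "opposite e = {(i, j), (x, y)}" "e = {(i, y), (x, j)}" "x \<noteq> i" "y \<noteq> j"
proof -
  obtain p q r s where e: "e = {(p, q), (r, s)}" "p \<noteq> r" "q \<noteq> s"
    using assms(1) unfolding diagonal_def by blast
  then have opp: "opposite e = {(p, s), (r, q)}"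
    by (simp add: opposite_diagonal)
  with assms(2) consider "i = p" "j = s" | "i = r" "j = q"
    by auto
  then show thesis
  proof cases
    case 1
    then show thesis using that[of r q] e opp by auto
  next
    case 2
    then show thesis using that[of p s] e opp by (auto simp: insert_commute)
  qed
qed

text \<open>The ends of \<open>e1\<close> are not opposite corners of \<open>e1\<close>, so both
  must be opposite corners of \<open>e2\<close>, which determines \<open>e2\<close>.\<close>

lemma degree_balance_pair:
  assumes diag: "diagonal e1" "diagonal e2"
    and bal: "\<And>v. of_bool (v \<in> e1) + of_bool (v \<in> e2) =
      (of_bool (v \<in> opposite e1) + of_bool (v \<in> opposite e2) :: nat)"
  shows "\<exists>i k j l. i \<noteq> k \<and> j \<noteq> l \<and> e1 = {(i, j), (k, l)} \<and> e2 = {(i, l), (k, j)}"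
proof -
  obtain i j k l where e1: "e1 = {(i, j), (k, l)}" "i \<noteq> k" "j \<noteq> l"
    using diag(1) unfolding diagonal_def by blast
  have "(i, j) \<in> opposite e2" "(k, l) \<in> opposite e2"
    using bal[of "(i, j)"] bal[of "(k, l)"] e1 by (auto simp: opposite_diagonal split: if_splits)
  moreover from diag(2) this(1) obtain x y where
    "opposite e2 = {(i, j), (x, y)}" "e2 = {(i, y), (x, j)}"
    by (rule opposite_vertexE)
  ultimately have "e2 = {(i, l), (k, j)}"
    using e1 by auto
  with e1 show ?thesis by blast
qed

text \<open>Each end of \<open>e1\<close> must be an opposite corner of \<open>e2\<close> or
  \<open>e3\<close>. One edge cannot serve both ends, so each serves one, and balance at further
  vertices fixes the remaining coordinates.\<close>

lemma degree_balance_triple: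
  assumes diag: "diagonal e1" "diagonal e2" "diagonal e3"
    and bal: "\<And>v. of_bool (v \<in> e1) + of_bool (v \<in> e2) + of_bool (v \<in> e3) =
      (of_bool (v \<in> opposite e1) + of_bool (v \<in> opposite e2) + of_bool (v \<in> opposite e3) :: nat)"
  shows "(\<exists>i k j1 j2 j3. i \<noteq> k \<and> j1 \<noteq> j2 \<and> j1 \<noteq> j3 \<and> j2 \<noteq> j3 \<and>
      {e1, e2, e3} = {{(i, j1), (k, j2)}, {(i, j2), (k, j3)}, {(k, j1), (i, j3)}}) \<or>
    (\<exists>i1 i2 i3 j l. j \<noteq> l \<and> i1 \<noteq> i2 \<and> i1 \<noteq> i3 \<and> i2 \<noteq> i3 \<and>
      {e1, e2, e3} = {{(i1, j), (i2, l)}, {(i2, j), (i3, l)}, {(i1, l), (i3, j)}})"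
    (is "?row e1 e2 e3 \<or> ?col e1 e2 e3")
proof -
  obtain i j k l where e1: "e1 = {(i, j), (k, l)}" "i \<noteq> k" "j \<noteq> l"
    using diag(1) unfolding diagonal_def by blast
  have o1: "opposite e1 = {(i, l), (k, j)}"
    using e1 by (simp add: opposite_diagonal)
  have linked: "?row e1 f g \<or> ?col e1 f g"
    if f: "diagonal f" "(i, j) \<in> opposite f" and g: "diagonal g" "(k, l) \<in> opposite g"
      and "(k, l) \<notin> opposite f"
      and bal: "\<And>v. of_bool (v \<in> e1) + of_bool (v \<in> f) + of_bool (v \<in> g) =
        (of_bool (v \<in> opposite e1) + of_bool (v \<in> opposite f) + of_bool (v \<in> opposite g) :: nat)"
    for f g
  proof -
    obtain x y where xy: "opposite f = {(i, j), (x, y)}" "f = {(i, y), (x, j)}" "x \<noteq> i" "y \<noteq> j"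
      using f by (rule opposite_vertexE)
    obtain z w where zw: "opposite g = {(k, l), (z, w)}" "g = {(k, w), (z, l)}" "z \<noteq> k" "w \<noteq> l"
      using g by (rule opposite_vertexE)
    show ?thesis
    \<comment> \<open>If \<open>f\<close> uses the columns of \<open>e1\<close>, all edges lie in
      columns \<open>j\<close>, \<open>l\<close> and the column configuration results; otherwise
      \<open>g\<close> is forced first and everything lies in rows \<open>i\<close>,
      \<open>k\<close>.\<close>
    proof (cases "y = l")
      case True
      then have "x \<noteq> k"
        using that(5) xy by auto
      then have "z = x \<and> w = j"
        using bal[of "(x, j)"] e1 o1 xy zw by (auto split: if_splits)
      then have "{e1, f, g} = {{(i, j), (k, l)}, {(k, j), (x, l)}, {(i, l), (x, j)}}"
        unfolding e1(1) xy(2) zw(2) using True by (simp add: insert_commute)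
      then show ?thesis
        using e1(2,3) xy(3) \<open>x \<noteq> k\<close>
        by (intro disjI2 exI[of _ i] exI[of _ k] exI[of _ x] exI[of _ j] exI[of _ l]) simp
    next
      case False
      then have "z = i \<and> w = y"
        using bal[of "(i, y)"] e1 o1 xy zw by (auto split: if_splits)
      moreover from this have "x = k"
        using bal[of "(k, j)"] e1 o1 xy zw False by (auto split: if_splits)
      ultimately have "{e1, f, g} = {{(i, j), (k, l)}, {(i, l), (k, y)}, {(k, j), (i, y)}}"
        unfolding e1(1) xy(2) zw(2) by (simp add: insert_commute)
      then show ?thesis
        using e1(2,3) xy(4) False
        by (intro disjI1 exI[of _ i] exI[of _ k] exI[of _ j] exI[of _ l] exI[of _ y]) simp
    qed
  qed
  \<comment> \<open>Otherwise \<open>e1\<close> and \<open>f\<close> would be opposite to each other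
    and cancel, leaving \<open>g\<close> to balance alone, although its ends are never its own
    opposite corners.\<close>
  have not_both: "\<not> ((i, j) \<in> opposite f \<and> (k, l) \<in> opposite f)"
    if f: "diagonal f" and g: "diagonal g"
      and bal: "\<And>v. of_bool (v \<in> e1) + of_bool (v \<in> f) + of_bool (v \<in> g) =
        (of_bool (v \<in> opposite e1) + of_bool (v \<in> opposite f) + of_bool (v \<in> opposite g) :: nat)"
    for f g
  proof
    assume "(i, j) \<in> opposite f \<and> (k, l) \<in> opposite f"
    then have ij: "(i, j) \<in> opposite f" and kl: "(k, l) \<in> opposite f"
      by simp_all
    obtain x y where xy: "opposite f = {(i, j), (x, y)}" "f = {(i, y), (x, j)}"
      using f ij by (rule opposite_vertexE)
    then have "x = k" "y = l"
      using kl e1(2) by simp_all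
    then have *: "opposite f = e1" "f = opposite e1"
      using xy e1(1) o1 by simp_all
    obtain p q r s where "g = {(p, q), (r, s)}" "p \<noteq> r" "q \<noteq> s"
      using g unfolding diagonal_def by blast
    then show False
      using bal[of "(p, q)"] * by (simp add: opposite_diagonal)
  qed
  have bal': "of_bool (v \<in> e1) + of_bool (v \<in> e3) + of_bool (v \<in> e2) =
      (of_bool (v \<in> opposite e1) + of_bool (v \<in> opposite e3) + of_bool (v \<in> opposite e2) :: nat)" for v
    using bal[of v] by simp
  have "(i, j) \<in> opposite e2 \<or> (i, j) \<in> opposite e3" "(k, l) \<in> opposite e2 \<or> (k, l) \<in> opposite e3"
    using bal[of "(i, j)"] bal[of "(k, l)"] e1 o1 by (auto split: if_splits)
  with not_both[OF diag(2,3) bal] not_both[OF diag(3,2) bal']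
  consider "(i, j) \<in> opposite e2" "(k, l) \<in> opposite e3" "(k, l) \<notin> opposite e2"
    | "(i, j) \<in> opposite e3" "(k, l) \<in> opposite e2" "(k, l) \<notin> opposite e3"
    by blast
  then show ?thesis
  proof cases
    case 1
    from linked[OF diag(2) 1(1) diag(3) 1(2,3) bal] show ?thesis .
  next
    case 2
    have "{e1, e2, e3} = {e1, e3, e2}"
      by blast
    with linked[OF diag(3) 2(1) diag(2) 2(2,3) bal'] show ?thesis
      by (simp only:)
  qed
qed

section \<open>The equivalences for two and three diagonal edges\<close>

theorem mainTheorem12:
  fixes m n :: nat and E :: "(nat \<times> nat) set set"
  assumes "m \<ge> 2" and "n \<ge> 2" and "grid_graph m n E"
  shows
   "(card (diagonal_edges E) = 2 \<longrightarrow>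
      (separable m n (rho E) \<longleftrightarrow>
        (\<exists>i k j l. i < m \<and> k < m \<and> j < n \<and> l < n \<and> i \<noteq> k \<and> j \<noteq> l \<and>
           diagonal_edges E = {{(i, j), (k, l)}, {(i, l), (k, j)}}))) \<and>
    (card (diagonal_edges E) = 3 \<longrightarrow>
      (separable m n (rho E) \<longleftrightarrow>
        ((\<exists>i k j1 j2 j3. i < m \<and> k < m \<and> j1 < n \<and> j2 < n \<and> j3 < n \<and> i \<noteq> k \<and>
            j1 \<noteq> j2 \<and> j1 \<noteq> j3 \<and> j2 \<noteq> j3 \<and>
            diagonal_edges E = {{(i, j1), (k, j2)}, {(i, j2), (k, j3)}, {(k, j1), (i, j3)}}) \<or>
         (\<exists>i1 i2 i3 j l. i1 < m \<and> i2 < m \<and> i3 < m \<and> j < n \<and> l < n \<and> j \<noteq> l \<and>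
            i1 \<noteq> i2 \<and> i1 \<noteq> i3 \<and> i2 \<noteq> i3 \<and>
            diagonal_edges E = {{(i1, j), (i2, l)}, {(i2, j), (i3, l)}, {(i1, l), (i3, j)}}))))"
proof (intro conjI impI)
  let ?D = "diagonal_edges E"
  \<comment> \<open>The combinatorial lemmas ignore the size of the grid; the coordinate bounds are
    recovered here.\<close>
  have grid: "i < m \<and> j < n \<and> k < m \<and> l < n" if "{(i, j), (k, l)} \<in> ?D" for i j k l
    using grid_graph_edge_subset[OF assms(3)] that by (force simp: diagonal_edges_eq grid_def)
  have ne: "E \<noteq> {}" if "card ?D > 0"
    using that by (auto simp: diagonal_edges_def)
  {
    assume card: "card ?D = 2"
    show "separable m n (rho E) \<longleftrightarrow>
        (\<exists>i k j l. i < m \<and> k < m \<and> j < n \<and> l < n \<and> i \<noteq> k \<and> j \<noteq> l \<and>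
           ?D = {{(i, j), (k, l)}, {(i, l), (k, j)}})" (is "_ \<longleftrightarrow> ?R")
    proof
      assume "separable m n (rho E)"
      note crit = degree_criterion[OF assms(3) ne this]
      obtain e1 e2 where D: "?D = {e1, e2}" "e1 \<noteq> e2"
        using card by (auto simp: card_2_iff)
      have "diagonal e1" "diagonal e2"
        using D(1) by (auto simp: diagonal_edges_eq)
      moreover have "of_bool (v \<in> e1) + of_bool (v \<in> e2) =
          (of_bool (v \<in> opposite e1) + of_bool (v \<in> opposite e2) :: nat)" for v
        using crit[of v] card D by (simp del: sum_of_bool_eq)
      ultimately obtain i k j l where
        "i \<noteq> k" "j \<noteq> l" "e1 = {(i, j), (k, l)}" "e2 = {(i, l), (k, j)}"
        using degree_balance_pair by metis
      then show ?R
        using D(1) grid[of i j k l] by blast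
    next
      assume ?R
      then obtain i k j l where *: "i < m" "k < m" "j < n" "l < n" "i \<noteq> k" "j \<noteq> l" and
        D: "?D = {{(i, j), (k, l)}, {(i, l), (k, j)}}"
        by blast
      \<comment> \<open>Distinctness turns the sum over the set of diagonal edges into a sum with
        one term per listed edge.\<close>
      have "{(i, j), (k, l)} \<noteq> {(i, l), (k, j)}"
        using * by (auto simp: doubleton_eq_iff)
      then have "product_cone m n (\<lambda>u v. \<Sum>e\<in>?D. edge_laplacian e u v)"
        unfolding D using product_cone_crossing_pair[OF *] by simp
      then show "separable m n (rho E)"
        using separable_rho_of_diagonal_edges assms(3) ne card by simp
    qed
  }
  assume card: "card ?D = 3"
  show "separable m n (rho E) \<longleftrightarrow>
        ((\<exists>i k j1 j2 j3. i < m \<and> k < m \<and> j1 < n \<and> j2 < n \<and> j3 < n \<and> i \<noteq> k \<and>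
            j1 \<noteq> j2 \<and> j1 \<noteq> j3 \<and> j2 \<noteq> j3 \<and>
            ?D = {{(i, j1), (k, j2)}, {(i, j2), (k, j3)}, {(k, j1), (i, j3)}}) \<or>
         (\<exists>i1 i2 i3 j l. i1 < m \<and> i2 < m \<and> i3 < m \<and> j < n \<and> l < n \<and> j \<noteq> l \<and>
            i1 \<noteq> i2 \<and> i1 \<noteq> i3 \<and> i2 \<noteq> i3 \<and>
            ?D = {{(i1, j), (i2, l)}, {(i2, j), (i3, l)}, {(i1, l), (i3, j)}}))"
    (is "_ \<longleftrightarrow> ?row \<or> ?col")
  proof
    assume "separable m n (rho E)"
    note crit = degree_criterion[OF assms(3) ne this]
    obtain e1 e2 e3 where D: "?D = {e1, e2, e3}" "e1 \<noteq> e2" "e1 \<noteq> e3" "e2 \<noteq> e3"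
      using card by (auto simp: card_3_iff)
    have diag: "diagonal e1" "diagonal e2" "diagonal e3"
      using D(1) by (auto simp: diagonal_edges_eq)
    have bal: "of_bool (v \<in> e1) + of_bool (v \<in> e2) + of_bool (v \<in> e3) =
        (of_bool (v \<in> opposite e1) + of_bool (v \<in> opposite e2) + of_bool (v \<in> opposite e3) :: nat)" for v
      using crit[of v] card D by (simp del: sum_of_bool_eq)
    from degree_balance_triple[OF diag bal, folded D(1)] show "?row \<or> ?col"
    proof (elim disjE exE conjE)
      fix i k j1 j2 j3
      assume *: "i \<noteq> k" "j1 \<noteq> j2" "j1 \<noteq> j3" "j2 \<noteq> j3"
        and row: "?D = {{(i, j1), (k, j2)}, {(i, j2), (k, j3)}, {(k, j1), (i, j3)}}"
      have "i < m" "k < m" "j1 < n" "j2 < n" "j3 < n"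
        using grid[of i j1 k j2] grid[of i j2 k j3] by (simp_all add: row)
      with * row show ?thesis
        by (intro disjI1 exI[of _ i] exI[of _ k] exI[of _ j1] exI[of _ j2] exI[of _ j3]) simp
    next
      fix i1 i2 i3 j l
      assume *: "j \<noteq> l" "i1 \<noteq> i2" "i1 \<noteq> i3" "i2 \<noteq> i3"
        and col: "?D = {{(i1, j), (i2, l)}, {(i2, j), (i3, l)}, {(i1, l), (i3, j)}}"
      have "i1 < m" "i2 < m" "i3 < m" "j < n" "l < n"
        using grid[of i1 j i2 l] grid[of i2 j i3 l] by (simp_all add: col)
      with * col show ?thesis
        by (intro disjI2 exI[of _ i1] exI[of _ i2] exI[of _ i3] exI[of _ j] exI[of _ l]) simp
    qed
  next
    assume "?row \<or> ?col"
    then have "product_cone m n (\<lambda>u v. \<Sum>e\<in>?D. edge_laplacian e u v)"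
    proof
      assume ?row
      then obtain i k j1 j2 j3 where
        *: "i < m" "k < m" "j1 < n" "j2 < n" "j3 < n" "i \<noteq> k" "j1 \<noteq> j2" "j1 \<noteq> j3" "j2 \<noteq> j3" and
        "?D = {{(i, j1), (k, j2)}, {(i, j2), (k, j3)}, {(k, j1), (i, j3)}}"
        by (elim exE conjE)
      \<comment> \<open>Reordering the ends of the third edge exposes the cyclic shift of
        columns.\<close>
      then have D: "?D = {{(i, j1), (k, j2)}, {(i, j2), (k, j3)}, {(i, j3), (k, j1)}}"
        by (simp only: insert_commute)
      have "{(i, j1), (k, j2)} \<noteq> {(i, j2), (k, j3)}" "{(i, j1), (k, j2)} \<noteq> {(i, j3), (k, j1)}"
        "{(i, j2), (k, j3)} \<noteq> {(i, j3), (k, j1)}"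
        using * by (auto simp: doubleton_eq_iff)
      then show ?thesis
        unfolding D using product_cone_crossing_triple[OF *] by (simp add: add.assoc)
    next
      assume ?col
      then obtain i1 i2 i3 j l where
        *: "j < n" "l < n" "i1 < m" "i2 < m" "i3 < m" "j \<noteq> l" "i1 \<noteq> i2" "i1 \<noteq> i3" "i2 \<noteq> i3" and
        "?D = {{(i1, j), (i2, l)}, {(i2, j), (i3, l)}, {(i1, l), (i3, j)}}"
        by (elim exE conjE)
      then have D: "?D = {{(i1, j), (i2, l)}, {(i2, j), (i3, l)}, {(i3, j), (i1, l)}}"
        by (simp only: insert_commute)
      have "{(i1, j), (i2, l)} \<noteq> {(i2, j), (i3, l)}" "{(i1, j), (i2, l)} \<noteq> {(i3, j), (i1, l)}"
        "{(i2, j), (i3, l)} \<noteq> {(i3, j), (i1, l)}"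
        using * by (auto simp: doubleton_eq_iff)
      then show ?thesis
        \<comment> \<open>The column configuration is the row configuration on the transposed grid,
          with \<open>j\<close>, \<open>l\<close> as rows and \<open>i1\<close>, \<open>i2\<close>,
          \<open>i3\<close> as columns.\<close>
        unfolding D using product_cone_swap[OF product_cone_crossing_triple[OF *]]
        by (simp add: add.assoc edge_laplacian_swap)
    qed
    then show "separable m n (rho E)"
      using separable_rho_of_diagonal_edges assms(3) ne card by simp
  qed
qed

end
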